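(* Let $G:\mathbb{C}^N\to\mathbb{C}^N$ be a polynomial map of degree $d$, and let $G_d$ denote the homogeneous map formed by the terms of degree $d$ of $G$. If $\mathbf{y}=\mathbf{0}$ is the unique solution in $\mathbb{C}^N$ of the homogeneous system $G_d(\mathbf{y})=\mathbf{0}$, then the polynomial system $G(\mathbf{y})=\mathbf{0}$ has finitely many solutions in $\mathbb{C}^N$.
   Context: The degree $d$ of a polynomial map is the maximum of the degrees of its components, and each component of $G_d$ is the homogeneous part of degree $d$ of the corresponding component of $G$ (possibly zero). *)

theory Defs
  imports "HOL-Analysis.Finite_Cartesian_Product" "HOL-Library.Poly_Mapping"
begin

text \<open>
  A monomial is a finitely supported map from variables to exponents, a polynomial a
  finitely supported map from monomials to coefficients. The ring structure on
  \<open>('a, 'n) mpoly\<close> is the convolution product of \<^theory>\<open>HOL-Library.Poly_Mapping\<close>.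
\<close>

type_synonym ('a, 'n) mpoly = "('n \<Rightarrow>\<^sub>0 nat) \<Rightarrow>\<^sub>0 'a"

definition monomial_degree :: "('n::finite \<Rightarrow>\<^sub>0 nat) \<Rightarrow> nat" where
  "monomial_degree m = (\<Sum>i\<in>UNIV. Poly_Mapping.lookup m i)"

definition eval_mpoly :: "('a::comm_semiring_1, 'n::finite) mpoly \<Rightarrow> 'a ^ 'n \<Rightarrow> 'a" where
  "eval_mpoly p x =
    (\<Sum>m\<in>Poly_Mapping.keys p.
       Poly_Mapping.lookup p m * (\<Prod>i\<in>UNIV. (x $ i) ^ Poly_Mapping.lookup m i))"

text \<open>The total degree; the zero polynomial gets degree 0.\<close>

definition total_degree :: "('a::zero, 'n::finite) mpoly \<Rightarrow> nat" where
  "total_degree p = Max (insert 0 (monomial_degree ` Poly_Mapping.keys p))"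

definition homogeneous_part ::
  "nat \<Rightarrow> ('a::comm_monoid_add, 'n::finite) mpoly \<Rightarrow> ('a, 'n) mpoly" where
  "homogeneous_part d p =
    (\<Sum>m\<in>{m \<in> Poly_Mapping.keys p. monomial_degree m = d}.
       Poly_Mapping.single m (Poly_Mapping.lookup p m))"

lemma lookup_homogeneous_part:
  "Poly_Mapping.lookup (homogeneous_part d p) m =
    (if monomial_degree m = d then Poly_Mapping.lookup p m else 0)"
  by (auto simp: homogeneous_part_def lookup_sum lookup_single when_def sum.delta
      in_keys_iff if_distrib cong: if_cong)

text \<open>
  A polynomial map is given by the vector of its component polynomials. Since
  \<open>'a\<close> is an infinite field in the application, these are determined by the
  function \<open>eval_poly_map G\<close>.
\<close>

type_synonym ('a, 'n) poly_map = "('a, 'n) mpoly ^ 'n"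

definition eval_poly_map ::
  "('a::comm_semiring_1, 'n::finite) poly_map \<Rightarrow> 'a ^ 'n \<Rightarrow> 'a ^ 'n" where
  "eval_poly_map G x = (\<chi> i. eval_mpoly (G $ i) x)"

definition poly_map_degree :: "('a::zero, 'n::finite) poly_map \<Rightarrow> nat" where
  "poly_map_degree G = Max (range (\<lambda>i. total_degree (G $ i)))"

text \<open>
  The same \<open>d\<close> is used for every component, so a component of degree less than
  \<open>d\<close> contributes the zero polynomial.
\<close>

definition homogeneous_part_map ::
  "nat \<Rightarrow> ('a::comm_monoid_add, 'n::finite) poly_map \<Rightarrow> ('a, 'n) poly_map" where
  "homogeneous_part_map d G = (\<chi> i. homogeneous_part d (G $ i))"

end

theory Submission
  imports Defs
    "HOL-Analysis.Analysis"
    "HOL-Library.Function_Algebras"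
    "HOL-Computational_Algebra.Fundamental_Theorem_Algebra"
begin

text \<open>
  The zero set \<open>V\<close> of \<open>G\<close> is bounded: by compactness of the unit sphere
  \<open>\<mu> |y|^d \<le> |G_d(y)|\<close> for some \<open>\<mu> > 0\<close>, while \<open>G - G_d\<close> grows at most like \<open>|y|^(d - 1)\<close>.
  Let \<open>J\<close> be the ideal of polynomial functions vanishing on \<open>V\<close>. If \<open>|c|\<close> exceeds the bound,
  then by the Nullstellensatz \<open>x_i - c\<close> is a unit modulo \<open>J\<close>. These uncountably many inverses
  are linearly dependent, because the space of polynomial functions has countable
  dimension. Clearing denominators gives a nonzero univariate \<open>q\<close> with \<open>q(x_i) \<in> J\<close>, so
  \<open>x_i\<close> takes finitely many values on \<open>V\<close>. The same dimension count also yields the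
  Nullstellensatz itself: if \<open>x_i - c\<close> were a unit modulo a proper ideal for every \<open>c\<close>,
  then some \<open>q(x_i)\<close> would lie in the ideal, yet it is a product of units.
\<close>

section \<open>Polynomial functions\<close>

interpretation fun_space: vector_space "\<lambda>(c::complex) (f::'a \<Rightarrow> complex) x. c * f x"
  by unfold_locales (auto simp: fun_eq_iff algebra_simps)

text \<open>Functions stand in for formal polynomials: identities in the ring become pointwise
  identities, and evaluation at a point is mere application.\<close>

inductive_set poly_funs :: "(complex ^ 'n::finite \<Rightarrow> complex) set" where
  const: "(\<lambda>x. c) \<in> poly_funs"
| coord: "(\<lambda>x. x $ i) \<in> poly_funs"
| add: "f \<in> poly_funs \<Longrightarrow> g \<in> poly_funs \<Longrightarrow> f + g \<in> poly_funs"
| mult: "f \<in> poly_funs \<Longrightarrow> g \<in> poly_funs \<Longrightarrow> f * g \<in> poly_funs"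

lemma zero_poly_funs: "0 \<in> poly_funs"
  using poly_funs.const[of 0] by (simp add: zero_fun_def)

lemma one_poly_funs: "1 \<in> poly_funs"
  using poly_funs.const[of 1] by (simp add: one_fun_def)

lemma uminus_poly_funs:
  assumes "f \<in> poly_funs"
  shows "- f \<in> poly_funs"
proof -
  have "- f = (\<lambda>x. -1) * f" by (simp add: fun_eq_iff)
  then show ?thesis using assms poly_funs.mult poly_funs.const by metis
qed

lemma diff_poly_funs: "f \<in> poly_funs \<Longrightarrow> g \<in> poly_funs \<Longrightarrow> f - g \<in> poly_funs"
  using poly_funs.add[OF _ uminus_poly_funs, of f g] by simp

lemma sum_poly_funs:
  "(\<And>a. a \<in> A \<Longrightarrow> f a \<in> poly_funs) \<Longrightarrow> (\<Sum>a\<in>A. f a) \<in> poly_funs"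
  by (induction A rule: infinite_finite_induct) (auto intro: zero_poly_funs poly_funs.add)

lemma prod_poly_funs:
  "(\<And>a. a \<in> A \<Longrightarrow> f a \<in> poly_funs) \<Longrightarrow> (\<Prod>a\<in>A. f a) \<in> poly_funs"
  by (induction A rule: infinite_finite_induct) (auto intro: one_poly_funs poly_funs.mult)

lemma power_poly_funs: "f \<in> poly_funs \<Longrightarrow> f ^ k \<in> poly_funs"
  by (induction k) (auto intro: one_poly_funs poly_funs.mult)

lemma fun_sum_apply: "(\<Sum>a\<in>A. f a) x = (\<Sum>a\<in>A. f a x :: complex)"
  by (induction A rule: infinite_finite_induct) auto

lemma fun_prod_apply: "(\<Prod>a\<in>A. f a) x = (\<Prod>a\<in>A. f a x :: complex)"
  by (induction A rule: infinite_finite_induct) auto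

lemma fun_power_apply: "(f ^ k) x = (f x :: complex) ^ k"
  by (induction k) auto

lemma poly_comp_poly_funs:
  assumes "f \<in> poly_funs"
  shows "(\<lambda>x. poly q (f x)) \<in> poly_funs"
proof (induction q)
  case 0
  then show ?case using poly_funs.const[of 0] by simp
next
  case (pCons a q)
  have "(\<lambda>x. poly (pCons a q) (f x)) = (\<lambda>x. a) + f * (\<lambda>x. poly q (f x))"
    by (simp add: fun_eq_iff)
  then show ?case using pCons assms by (auto intro: poly_funs.intros)
qed

lemma eval_mpoly_poly_funs: "eval_mpoly p \<in> poly_funs"
proof -
  have "eval_mpoly p = (\<Sum>m\<in>Poly_Mapping.keys p.
      (\<lambda>x. Poly_Mapping.lookup p m) * (\<Prod>i\<in>UNIV. (\<lambda>x. x $ i) ^ Poly_Mapping.lookup m i))"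
    by (rule ext) (simp add: eval_mpoly_def fun_sum_apply fun_prod_apply fun_power_apply)
  then show ?thesis
    by (auto intro!: sum_poly_funs prod_poly_funs power_poly_funs poly_funs.intros)
qed

section \<open>Countable dimension of the space of polynomial functions\<close>

definition monomial_fun :: "('n::finite \<Rightarrow> nat) \<Rightarrow> complex ^ 'n \<Rightarrow> complex" where
  "monomial_fun m x = (\<Prod>i\<in>UNIV. x $ i ^ m i)"

text \<open>Linearity in each factor in turn reduces the product to that of two monomials, whose
  exponents add.\<close>

lemma span_monomial_fun_mult:
  assumes "f \<in> fun_space.span (range monomial_fun)" and "g \<in> fun_space.span (range monomial_fun)"
  shows "f * g \<in> fun_space.span (range monomial_fun)"
proof -
  let ?S = "fun_space.span (range monomial_fun)"
  have mono: "monomial_fun m * g \<in> ?S" for m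
    using assms(2)
  proof (induction g rule: fun_space.span_induct_alt)
    case base
    then show ?case by (metis fun_space.span_zero mult_zero_right)
  next
    case (step c b y)
    then obtain n where n: "b = monomial_fun n" by blast
    have "monomial_fun m * b = monomial_fun (\<lambda>i. m i + n i)"
      by (simp add: n fun_eq_iff monomial_fun_def power_add prod.distrib)
    then have "monomial_fun m * b \<in> ?S" by (simp add: fun_space.span_base)
    moreover have "monomial_fun m * ((\<lambda>x. c * b x) + y)
        = (\<lambda>x. c * (monomial_fun m * b) x) + monomial_fun m * y"
      by (simp add: fun_eq_iff algebra_simps)
    ultimately show ?case
      by (simp only:) (intro fun_space.span_add fun_space.span_scale step)
  qed
  show ?thesis using assms(1)
  proof (induction f rule: fun_space.span_induct_alt)
    case base
    then show ?case by (metis fun_space.span_zero mult_zero_left)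
  next
    case (step c b y)
    then have "b * g \<in> ?S" using mono by auto
    moreover have "((\<lambda>x. c * b x) + y) * g = (\<lambda>x. c * (b * g) x) + y * g"
      by (simp add: fun_eq_iff algebra_simps)
    ultimately show ?case
      by (simp only:) (intro fun_space.span_add fun_space.span_scale step)
  qed
qed

text \<open>Exponent vectors on a finite index type form a countable type, so this spanning set is
  countable.\<close>

lemma poly_funs_subset_span: "poly_funs \<subseteq> fun_space.span (range monomial_fun)"
proof
  fix f :: "complex ^ 'n \<Rightarrow> complex" assume "f \<in> poly_funs"
  then show "f \<in> fun_space.span (range monomial_fun)"
  proof induction
    case (const c)
    have "(\<lambda>x :: complex ^ 'n. c * monomial_fun (\<lambda>i. 0) x) \<in> fun_space.span (range monomial_fun)"
      by (intro fun_space.span_scale fun_space.span_base rangeI)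
    moreover have "monomial_fun (\<lambda>i. 0) x = 1" for x :: "complex ^ 'n"
      by (simp add: monomial_fun_def)
    ultimately show ?case by simp
  next
    case (coord i)
    have "x $ i = monomial_fun (\<lambda>j. if j = i then 1 else 0) x" for x :: "complex ^ 'n"
    proof -
      have "monomial_fun (\<lambda>j. if j = i then 1 else 0) x = (\<Prod>j\<in>UNIV. if j = i then x $ j else 1)"
        unfolding monomial_fun_def by (rule prod.cong) auto
      then show ?thesis by simp
    qed
    then show ?case by (simp add: fun_space.span_base)
  qed (rule fun_space.span_add span_monomial_fun_mult; assumption)+
qed

text \<open>Each vector of the span already lies in the span of a finite subset of \<open>B\<close>.
  There are countably many such subsets, and the span of each contains only finitely many elements
  of the independent set \<open>S\<close>.\<close>

lemma (in vector_space) countable_independent_in_span: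
  assumes "countable B" "independent S" "S \<subseteq> span B"
  shows "countable S"
proof -
  have "S \<subseteq> (\<Union>T\<in>{T. finite T \<and> T \<subseteq> B}. S \<inter> span T)"
  proof
    fix s assume "s \<in> S"
    then have "s \<in> span B" using assms by auto
    then obtain T where "finite T" "T \<subseteq> B" "s \<in> span T"
      by (auto simp: span_explicit intro: span_sum span_scale span_base)
    then show "s \<in> (\<Union>T\<in>{T. finite T \<and> T \<subseteq> B}. S \<inter> span T)" using \<open>s \<in> S\<close> by auto
  qed
  moreover have "finite (S \<inter> span T)" if "finite T" for T
    using independent_span_bound[OF that, of "S \<inter> span T"] assms(2)
    by (meson Int_lower1 Int_lower2 independent_mono)
  then have "countable (\<Union>T\<in>{T. finite T \<and> T \<subseteq> B}. S \<inter> span T)"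
    by (intro countable_UN countable_Collect_finite_subset assms(1)) (auto intro: countable_finite)
  ultimately show ?thesis by (rule countable_subset)
qed

section \<open>Ideals of polynomial functions\<close>

definition poly_ideal :: "(complex ^ 'n::finite \<Rightarrow> complex) set \<Rightarrow> bool" where
  "poly_ideal J \<longleftrightarrow> J \<subseteq> poly_funs \<and> 0 \<in> J \<and> (\<forall>f\<in>J. \<forall>g\<in>J. f + g \<in> J) \<and>
     (\<forall>p\<in>poly_funs. \<forall>f\<in>J. p * f \<in> J)"

lemma poly_idealD:
  assumes "poly_ideal J"
  shows "f \<in> J \<Longrightarrow> f \<in> poly_funs" and "0 \<in> J"
    and "f \<in> J \<Longrightarrow> g \<in> J \<Longrightarrow> f + g \<in> J"
    and "p \<in> poly_funs \<Longrightarrow> f \<in> J \<Longrightarrow> p * f \<in> J"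
  using assms unfolding poly_ideal_def by auto

lemma poly_ideal_uminus:
  assumes "poly_ideal J" "f \<in> J" shows "- f \<in> J"
proof -
  have "- f = (\<lambda>x. -1) * f" by (simp add: fun_eq_iff)
  then show ?thesis using assms poly_idealD(4) poly_funs.const by metis
qed

lemma poly_ideal_diff: "poly_ideal J \<Longrightarrow> f \<in> J \<Longrightarrow> g \<in> J \<Longrightarrow> f - g \<in> J"
  using poly_idealD(3)[OF _ _ poly_ideal_uminus, of J f g] by simp

lemma poly_ideal_sum:
  assumes "poly_ideal J" "\<And>a. a \<in> A \<Longrightarrow> f a \<in> J"
  shows "(\<Sum>a\<in>A. f a) \<in> J"
  using assms(2)
  by (induction A rule: infinite_finite_induct) (auto intro: poly_idealD[OF assms(1)])

lemma poly_ideal_const_mem: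
  fixes J :: "(complex ^ 'n::finite \<Rightarrow> complex) set"
  assumes "poly_ideal J" "(\<lambda>x. c) \<in> J" "c \<noteq> 0"
  shows "1 \<in> J"
proof -
  have "(\<lambda>x. inverse c) * (\<lambda>x. c) \<in> J"
    using assms poly_idealD(4) poly_funs.const by blast
  moreover have "(\<lambda>x. inverse c) * (\<lambda>x. c) = (1 :: complex ^ 'n \<Rightarrow> complex)"
    using assms(3) by (simp add: fun_eq_iff)
  ultimately show ?thesis by simp
qed

text \<open>For an ideal \<open>J\<close> this is the ideal \<open>J + (f)\<close>; that it contains
  \<open>1\<close> expresses that \<open>f\<close> is a unit modulo \<open>J\<close>.\<close>

definition adjoin ::
  "(complex ^ 'n::finite \<Rightarrow> complex) set \<Rightarrow> (complex ^ 'n \<Rightarrow> complex)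
    \<Rightarrow> (complex ^ 'n \<Rightarrow> complex) set" where
  "adjoin J f = {g + p * f | g p. g \<in> J \<and> p \<in> poly_funs}"

lemma poly_ideal_adjoin:
  fixes J :: "(complex ^ 'n::finite \<Rightarrow> complex) set"
  assumes J: "poly_ideal J" and f: "f \<in> poly_funs"
  shows "poly_ideal (adjoin J f)"
  unfolding poly_ideal_def
proof (intro conjI ballI)
  show "adjoin J f \<subseteq> poly_funs"
    unfolding adjoin_def using f poly_idealD(1)[OF J] poly_funs.add poly_funs.mult by blast
  have "0 = 0 + 0 * f" by simp
  then show "0 \<in> adjoin J f"
    unfolding adjoin_def using poly_idealD(2)[OF J] zero_poly_funs by blast
next
  fix u v assume "u \<in> adjoin J f" "v \<in> adjoin J f"
  then obtain g p h q where *: "u = g + p * f" "v = h + q * f"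
    "g \<in> J" "h \<in> J" "p \<in> poly_funs" "q \<in> poly_funs"
    unfolding adjoin_def by blast
  have "u + v = (g + h) + (p + q) * f" by (simp add: * algebra_simps)
  then show "u + v \<in> adjoin J f"
    unfolding adjoin_def using * poly_idealD(3)[OF J] poly_funs.add by blast
next
  fix r u :: "complex ^ 'n \<Rightarrow> complex" assume r: "r \<in> poly_funs" and "u \<in> adjoin J f"
  then obtain g p where *: "u = g + p * f" "g \<in> J" "p \<in> poly_funs"
    unfolding adjoin_def by blast
  have "r * u = r * g + (r * p) * f" by (simp add: * algebra_simps)
  then show "r * u \<in> adjoin J f"
    unfolding adjoin_def using * r poly_idealD(4)[OF J] poly_funs.mult by blast
qed

lemma subset_adjoin: "J \<subseteq> adjoin J f"
proof
  fix g assume "g \<in> J"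
  moreover have "g = g + 0 * f" by simp
  ultimately show "g \<in> adjoin J f" unfolding adjoin_def using zero_poly_funs by blast
qed

lemma mem_adjoin:
  assumes "poly_ideal J" shows "f \<in> adjoin J f"
proof -
  have "f = 0 + 1 * f" by simp
  then show ?thesis
    unfolding adjoin_def using poly_idealD(2)[OF assms] one_poly_funs by blast
qed

lemma one_mem_adjoinE:
  assumes "poly_ideal J" "1 \<in> adjoin J f"
  obtains u where "u \<in> poly_funs" "u * f - 1 \<in> J"
proof -
  obtain g p where *: "1 = g + p * f" "g \<in> J" "p \<in> poly_funs"
    using assms(2) unfolding adjoin_def by blast
  then have "p * f - 1 = - g" by (simp add: algebra_simps)
  then show thesis using that[of p] * poly_ideal_uminus[OF assms(1)] by simp
qed

section \<open>Units modulo an ideal and the weak Nullstellensatz\<close>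

text \<open>
  A polynomial relation comes from a linear dependence between the inverses of the
  uncountably many elements \<open>f - c\<close>, after clearing denominators.
\<close>

lemma algebraic_if_uncountably_many_units:
  fixes J :: "(complex ^ 'n::finite \<Rightarrow> complex) set"
  assumes J: "poly_ideal J" and proper: "1 \<notin> J" and f: "f \<in> poly_funs"
    and C: "uncountable C" and unit: "\<And>c. c \<in> C \<Longrightarrow> 1 \<in> adjoin J (f - (\<lambda>x. c))"
  obtains q where "q \<noteq> 0" "(\<lambda>x. poly q (f x)) \<in> J"
proof -
  have "\<exists>u. \<forall>c\<in>C. u c \<in> poly_funs \<and> u c * (f - (\<lambda>x. c)) - 1 \<in> J"
    using unit one_mem_adjoinE[OF J] by (intro bchoice) metis
  then obtain u where u: "\<And>c. c \<in> C \<Longrightarrow> u c \<in> poly_funs"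
    and uJ: "\<And>c. c \<in> C \<Longrightarrow> u c * (f - (\<lambda>x. c)) - 1 \<in> J" by metis
  \<comment> \<open>A common inverse of \<open>f - c\<close> and \<open>f - c'\<close> would satisfy
    \<open>(c' - c) * u c \<in> J\<close>, hence lie in \<open>J\<close>, which is impossible for a
    unit modulo a proper ideal. So there are uncountably many inverses.\<close>
  have inj: "inj_on u C"
  proof (rule inj_onI, rule ccontr)
    fix c c' assume c: "c \<in> C" "c' \<in> C" and eq: "u c = u c'" and ne: "c \<noteq> c'"
    have "(u c * (f - (\<lambda>x. c)) - 1) - (u c' * (f - (\<lambda>x. c')) - 1) \<in> J"
      using uJ c poly_ideal_diff[OF J] by blast
    moreover have "(u c * (f - (\<lambda>x. c)) - 1) - (u c' * (f - (\<lambda>x. c')) - 1) = (\<lambda>x. c' - c) * u c"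
      using eq by (simp add: fun_eq_iff algebra_simps)
    ultimately have "(\<lambda>x. c' - c) * u c \<in> J" by simp
    then have "(\<lambda>x. inverse (c' - c)) * ((\<lambda>x. c' - c) * u c) \<in> J"
      using poly_idealD(4)[OF J] poly_funs.const by blast
    moreover have "(\<lambda>x. inverse (c' - c)) * ((\<lambda>x. c' - c) * u c) = u c"
      using ne by (simp add: fun_eq_iff)
    ultimately have "u c \<in> J" by simp
    then have "(f - (\<lambda>x. c)) * u c - (u c * (f - (\<lambda>x. c)) - 1) \<in> J"
      by (intro poly_ideal_diff[OF J] poly_idealD(4)[OF J] diff_poly_funs poly_funs.const f uJ c(1))
    then show False using proper by (simp add: mult.commute)
  qed
  have "uncountable (u ` C)" using inj C by (simp add: countable_image_inj_eq)
  moreover have "countable (range (monomial_fun :: ('n \<Rightarrow> nat) \<Rightarrow> _))" by simp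
  moreover have "u ` C \<subseteq> fun_space.span (range monomial_fun)"
    using u poly_funs_subset_span by blast
  ultimately have "fun_space.dependent (u ` C)"
    using fun_space.countable_independent_in_span by blast
  then obtain T a v where T: "finite T" "T \<subseteq> u ` C" and v: "v \<in> T" "a v \<noteq> 0"
    and dep: "(\<Sum>w\<in>T. (\<lambda>x. a w * w x)) = 0"
    unfolding fun_space.dependent_explicit by blast
  from finite_subset_image[OF T] obtain S where S: "S \<subseteq> C" "finite S" "T = u ` S" by blast
  have injS: "inj_on u S" using inj S(1) inj_on_subset by blast
  from v S obtain c0 where c0: "c0 \<in> S" "a (u c0) \<noteq> 0" by blast
  have dep': "(\<Sum>c\<in>S. a (u c) * u c x) = 0" for x
    using fun_cong[OF dep, of x] by (simp add: fun_sum_apply S(3) sum.reindex[OF injS])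
  \<comment> \<open>The numerator of the sum of the fractions \<open>a (u c) / (X - c)\<close> over
    their common denominator.\<close>
  define q where "q = (\<Sum>c\<in>S. smult (a (u c)) (\<Prod>c'\<in>S - {c}. [:- c', 1:]))"
  \<comment> \<open>At \<open>c0\<close> every summand with \<open>c \<noteq> c0\<close> contains
    the vanishing factor \<open>c0 - c0\<close>.\<close>
  have "poly q c0 = (\<Sum>c\<in>S. if c = c0 then a (u c0) * (\<Prod>c'\<in>S - {c0}. c0 - c') else 0)"
    unfolding q_def poly_sum using c0(1) S(2)
    by (intro sum.cong) (auto simp: poly_prod algebra_simps intro!: prod_zero)
  also have "\<dots> \<noteq> 0" using c0 S(2) by simp
  finally have "q \<noteq> 0" by auto
  moreover have "(\<lambda>x. poly q (f x)) \<in> J"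
  proof -
    define D where "D c = (\<Prod>c'\<in>S - {c}. f - (\<lambda>x. c'))" for c
    have D: "D c \<in> poly_funs" for c
      unfolding D_def by (intro prod_poly_funs diff_poly_funs f poly_funs.const)
    have full: "(\<Prod>c'\<in>S. f x - c') = (f x - c) * D c x" if "c \<in> S" for c x
      using prod.remove[OF S(2) that, of "\<lambda>c'. f x - c'"] by (simp add: D_def fun_prod_apply)
    have "poly q (f x) = (\<Sum>c\<in>S. a (u c) * D c x)" for x
      by (simp add: q_def D_def poly_sum poly_prod fun_prod_apply)
    \<comment> \<open>Multiplying the dependence \<open>dep'\<close> by the full product
      \<open>(f - c) * D c\<close> gives a sum equal to zero. Subtracting it turns each summand into
      a multiple of \<open>u c * (f - c) - 1\<close>, which lies in \<open>J\<close>.\<close>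
    also have "(\<Sum>c\<in>S. a (u c) * D c x)
        = (\<Sum>c\<in>S. - a (u c) * D c x * (u c x * (f x - c) - 1))" for x
    proof -
      have "(\<Sum>c\<in>S. a (u c) * D c x * (u c x * (f x - c)))
          = (\<Sum>c\<in>S. (\<Prod>c'\<in>S. f x - c') * (a (u c) * u c x))"
        by (rule sum.cong) (auto simp: full)
      also have "\<dots> = 0" by (simp flip: sum_distrib_left add: dep')
      finally show ?thesis by (simp add: algebra_simps sum_subtractf sum_negf sum.distrib)
    qed
    finally have "(\<lambda>x. poly q (f x)) =
        (\<Sum>c\<in>S. ((\<lambda>x. - a (u c)) * D c) * (u c * (f - (\<lambda>x. c)) - 1))"
      by (simp add: fun_eq_iff fun_sum_apply)
    also have "\<dots> \<in> J"
      using S(1)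
      by (intro poly_ideal_sum J poly_idealD(4)[OF J] poly_funs.mult D poly_funs.const uJ) auto
    finally show ?thesis .
  qed
  ultimately show thesis using that by blast
qed

text \<open>Over the complex numbers \<open>q\<close> splits into linear factors. If every
  \<open>f - c\<close> were a unit modulo \<open>J\<close>, these factors could be cancelled one by
  one until a nonzero constant remained in \<open>J\<close>.\<close>

lemma proper_adjoin_if_algebraic:
  assumes J: "poly_ideal J" and proper: "1 \<notin> J" and f: "f \<in> poly_funs"
    and q: "q \<noteq> 0" "(\<lambda>x. poly q (f x)) \<in> J"
  shows "\<exists>c. 1 \<notin> adjoin J (f - (\<lambda>x. c))"
  using q
proof (induction "degree q" arbitrary: q)
  case 0
  then obtain b where "q = [:b:]" by (metis degree_eq_zeroE)
  then show ?case using 0 proper poly_ideal_const_mem[OF J, of b] by auto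
next
  case (Suc k)
  then have "\<not> constant (poly q)" by (metis constant_degree nat.distinct(1))
  then obtain r where "poly q r = 0" using fundamental_theorem_of_algebra by blast
  then obtain q' where q': "q = [:- r, 1:] * q'" by (metis dvdE poly_eq_0_iff_dvd)
  have ne: "q' \<noteq> 0" using q' Suc.prems by auto
  then have deg: "k = degree q'"
    using Suc.hyps(2) unfolding q' by (subst (asm) degree_mult_eq) auto
  show ?case
  proof (rule ccontr)
    assume contra: "\<nexists>c. 1 \<notin> adjoin J (f - (\<lambda>x. c))"
    then obtain u where u: "u \<in> poly_funs" "u * (f - (\<lambda>x. r)) - 1 \<in> J"
      using one_mem_adjoinE[OF J] by blast
    \<comment> \<open>As \<open>q(f) = (f - r) * q'(f)\<close> and \<open>u\<close> inverts
      \<open>f - r\<close> modulo \<open>J\<close>, the element \<open>u * q(f)\<close> is congruent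
      to \<open>q'(f)\<close>.\<close>
    have "u * (\<lambda>x. poly q (f x)) - (\<lambda>x. poly q' (f x)) * (u * (f - (\<lambda>x. r)) - 1) \<in> J"
      by (intro poly_ideal_diff[OF J] poly_idealD(4)[OF J] u Suc.prems poly_comp_poly_funs f)
    also have "u * (\<lambda>x. poly q (f x)) - (\<lambda>x. poly q' (f x)) * (u * (f - (\<lambda>x. r)) - 1)
        = (\<lambda>x. poly q' (f x))"
      by (simp add: fun_eq_iff q' algebra_simps)
    finally show False using Suc.hyps(1)[OF deg ne] contra by blast
  qed
qed

lemma ex_proper_adjoin:
  assumes "poly_ideal J" "1 \<notin> J" "f \<in> poly_funs"
  shows "\<exists>c. 1 \<notin> adjoin J (f - (\<lambda>x. c))"
proof (rule ccontr)
  assume "\<nexists>c. 1 \<notin> adjoin J (f - (\<lambda>x. c))"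
  moreover have "uncountable (UNIV :: complex set)" by (rule uncountable_UNIV_complex)
  ultimately obtain q where "q \<noteq> 0" "(\<lambda>x. poly q (f x)) \<in> J"
    using algebraic_if_uncountably_many_units[OF assms] by (metis UNIV_I)
  then show False
    using proper_adjoin_if_algebraic[OF assms] \<open>\<nexists>c. 1 \<notin> adjoin J (f - (\<lambda>x. c))\<close> by blast
qed

text \<open>Treating the coordinates one after another with \<open>ex_proper_adjoin\<close> enlarges
  \<open>J\<close> to a proper ideal \<open>K\<close> containing all \<open>x_i - a_i\<close>.
  Modulo \<open>K\<close> each \<open>g\<close> is congruent to the constant \<open>g a\<close>, and
  a proper ideal contains no nonzero constant.\<close>

theorem weak_nullstellensatz:
  fixes J :: "(complex ^ 'n::finite \<Rightarrow> complex) set"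
  assumes J: "poly_ideal J" and proper: "1 \<notin> J"
  obtains a where "\<And>g. g \<in> J \<Longrightarrow> g a = 0"
proof -
  have "\<exists>K. poly_ideal K \<and> 1 \<notin> K \<and> J \<subseteq> K \<and> (\<forall>i\<in>S. \<exists>c. (\<lambda>x. x $ i) - (\<lambda>x. c) \<in> K)"
    if "finite S" for S :: "'n set"
    using that
  proof induction
    case empty
    then show ?case using assms by blast
  next
    case (insert i S)
    then obtain K where K: "poly_ideal K" "1 \<notin> K" "J \<subseteq> K"
      "\<forall>i\<in>S. \<exists>c. (\<lambda>x. x $ i) - (\<lambda>x. c) \<in> K" by blast
    obtain c where c: "1 \<notin> adjoin K ((\<lambda>x. x $ i) - (\<lambda>x. c))"
      using ex_proper_adjoin[OF K(1,2) poly_funs.coord] by blast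
    have "poly_ideal (adjoin K ((\<lambda>x. x $ i) - (\<lambda>x. c)))"
      by (intro poly_ideal_adjoin K diff_poly_funs poly_funs.intros)
    then show ?case
      using c K(3,4) subset_adjoin[of K] mem_adjoin[OF K(1)]
      by (intro exI[of _ "adjoin K ((\<lambda>x. x $ i) - (\<lambda>x. c))"]) blast
  qed
  from this[OF finite[of UNIV]] obtain K where K: "poly_ideal K" "1 \<notin> K" "J \<subseteq> K"
    and "\<And>i. \<exists>c. (\<lambda>x. x $ i) - (\<lambda>x. c) \<in> K" by blast
  then obtain b where b: "\<And>i. (\<lambda>x. x $ i) - (\<lambda>x. b i) \<in> K" by metis
  define a :: "complex ^ 'n" where "a = (\<chi> i. b i)"
  have diff: "g - (\<lambda>x. g a) \<in> K" if "g \<in> poly_funs" for g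
    using that
  proof induction
    case (const c)
    have "(\<lambda>x. c) - (\<lambda>x. c) = (0 :: complex ^ 'n \<Rightarrow> complex)" by (simp add: fun_eq_iff)
    then show ?case by (simp only: poly_idealD(2)[OF K(1)])
  next
    case (coord i)
    have "a $ i = b i" by (simp add: a_def)
    then show ?case using b by (simp only:)
  next
    case (add f g)
    have "f + g - (\<lambda>x. (f + g) a) =
      (f - (\<lambda>x. f a)) + (g - (\<lambda>x. g a))"
      by (simp add: fun_eq_iff)
    then show ?case by (simp only:) (intro poly_idealD(3)[OF K(1)] add.IH)
  next
    case (mult f g)
    have "f * g - (\<lambda>x. (f * g) a) = f * (g - (\<lambda>x. g a)) + (\<lambda>x. g a) * (f - (\<lambda>x. f a))"
      by (simp add: fun_eq_iff algebra_simps)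
    then show ?case
      by (simp only:) (intro poly_idealD(3,4)[OF K(1)] poly_funs.const mult)
  qed
  have "g a = 0" if "g \<in> J" for g
  proof (rule ccontr)
    assume "g a \<noteq> 0"
    have "g \<in> K" using that K(3) by blast
    then have "g - (g - (\<lambda>x. g a)) \<in> K"
      using diff poly_ideal_diff[OF K(1)] poly_idealD(1)[OF K(1)] by blast
    moreover have "g - (g - (\<lambda>x. g a)) = (\<lambda>x. g a)" by (simp add: fun_eq_iff)
    ultimately have "(\<lambda>x. g a) \<in> K" by (simp only:)
    then show False using poly_ideal_const_mem[OF K(1)] K(2) \<open>g a \<noteq> 0\<close> by blast
  qed
  then show thesis using that by blast
qed

section \<open>Finiteness of bounded algebraic sets\<close>

theorem finite_bounded_algebraic_set:
  fixes E :: "(complex ^ 'n::finite \<Rightarrow> complex) set"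
  assumes E: "E \<subseteq> poly_funs" and bdd: "bounded {y. \<forall>g\<in>E. g y = 0}"
  shows "finite {y. \<forall>g\<in>E. g y = 0}"
\<comment> \<open>The empty zero set is split off because the ideal of functions vanishing on it
  contains \<open>1\<close>.\<close>
proof (cases "{y. \<forall>g\<in>E. g y = 0} = {}")
  case False
  define V where "V = {y. \<forall>g\<in>E. g y = 0}"
  define J where "J = {g \<in> poly_funs. \<forall>y\<in>V. g y = 0}"
  have J: "poly_ideal J"
    unfolding poly_ideal_def J_def
    by (simp add: zero_poly_funs poly_funs.add poly_funs.mult subset_iff)
  have proper: "1 \<notin> J" using False by (auto simp: J_def V_def)
  obtain R where R: "\<And>y. y \<in> V \<Longrightarrow> norm y \<le> R"
    using bdd unfolding V_def bounded_iff by blast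
  have "\<exists>F. finite F \<and> (\<forall>y\<in>V. y $ i \<in> F)" for i
  proof -
    \<comment> \<open>Otherwise the Nullstellensatz would yield a point of \<open>V\<close> whose
      coordinate \<open>c\<close> has norm beyond the bound \<open>R\<close>.\<close>
    have "1 \<in> adjoin J ((\<lambda>x. x $ i) - (\<lambda>x. c))" if "c \<in> - cball 0 R" for c
    proof (rule ccontr)
      let ?K = "adjoin J ((\<lambda>x. x $ i) - (\<lambda>x. c))"
      assume "1 \<notin> ?K"
      moreover have "poly_ideal ?K"
        by (intro poly_ideal_adjoin J diff_poly_funs poly_funs.intros)
      ultimately obtain a where a: "\<And>g. g \<in> ?K \<Longrightarrow> g a = 0"
        using weak_nullstellensatz by blast
      have "E \<subseteq> J" using E by (auto simp: J_def V_def)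
      then have "a \<in> V" using a subset_adjoin[of J] by (auto simp: V_def)
      moreover have "a $ i = c" using a[OF mem_adjoin[OF J]] by simp
      ultimately show False
        using R[of a] Finite_Cartesian_Product.norm_nth_le[of a i] that by auto
    qed
    moreover have "uncountable (- cball (0::complex) R)"
    proof -
      \<comment> \<open>The absolute value spares a proof that \<open>R\<close> is
        nonnegative.\<close>
      have "ball (complex_of_real (\<bar>R\<bar> + 1)) 1 \<subseteq> - cball 0 R"
      proof
        fix c assume "c \<in> ball (complex_of_real (\<bar>R\<bar> + 1)) 1"
        then have "norm (complex_of_real (\<bar>R\<bar> + 1) - c) < 1" by (simp only: mem_ball dist_norm)
        moreover have "norm (complex_of_real (\<bar>R\<bar> + 1)) = \<bar>R\<bar> + 1" by (subst norm_of_real) simp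
        moreover have "norm (complex_of_real (\<bar>R\<bar> + 1))
            \<le> norm c + norm (complex_of_real (\<bar>R\<bar> + 1) - c)"
          by (rule norm_triangle_sub)
        ultimately have "R < norm c" by linarith
        then show "c \<in> - cball 0 R" by simp
      qed
      then show ?thesis
        by (meson countable_subset uncountable_ball zero_less_one)
    qed
    ultimately obtain q where q: "q \<noteq> 0" "(\<lambda>x. poly q (x $ i)) \<in> J"
      using algebraic_if_uncountably_many_units[OF J proper poly_funs.coord] by metis
    then have "\<forall>y\<in>V. y $ i \<in> {z. poly q z = 0}" by (auto simp: J_def)
    then show ?thesis using poly_roots_finite[OF q(1)] by blast
  qed
  then obtain F where F: "\<And>i. finite (F i)" "\<And>i y. y \<in> V \<Longrightarrow> y $ i \<in> F i" by metis
  have "V \<subseteq> vec_lambda ` (PiE UNIV F)"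
  proof
    fix y assume "y \<in> V"
    then have "vec_nth y \<in> PiE UNIV F" using F(2) by auto
    then show "y \<in> vec_lambda ` (PiE UNIV F)" by (metis image_eqI vec_lambda_eta)
  qed
  moreover have "finite (PiE UNIV F)" using F(1) by (intro finite_PiE) auto
  ultimately show ?thesis unfolding V_def using finite_subset by blast
qed (simp only: finite.emptyI)

section \<open>Growth of a polynomial map at infinity\<close>

lemma eval_mpoly_split:
  fixes p :: "(complex, 'n::finite) mpoly"
  assumes "total_degree p \<le> d"
  shows "eval_mpoly p x = eval_mpoly (homogeneous_part d p) x +
    (\<Sum>m\<in>{m\<in>Poly_Mapping.keys p. monomial_degree m < d}.
       Poly_Mapping.lookup p m * (\<Prod>i\<in>UNIV. (x $ i) ^ Poly_Mapping.lookup m i))"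
proof -
  have "monomial_degree m \<le> d" if "m \<in> Poly_Mapping.keys p" for m
    using that assms unfolding total_degree_def by (subst (asm) Max_le_iff) auto
  then have "Poly_Mapping.keys p = Poly_Mapping.keys (homogeneous_part d p) \<union>
      {m\<in>Poly_Mapping.keys p. monomial_degree m < d}"
    by (auto simp: in_keys_iff lookup_homogeneous_part le_neq_implies_less split: if_splits)
  moreover have "Poly_Mapping.keys (homogeneous_part d p) \<inter>
      {m\<in>Poly_Mapping.keys p. monomial_degree m < d} = {}"
    by (auto simp: in_keys_iff lookup_homogeneous_part)
  moreover have "(\<Sum>m\<in>Poly_Mapping.keys (homogeneous_part d p).
       Poly_Mapping.lookup p m * (\<Prod>i\<in>UNIV. (x $ i) ^ Poly_Mapping.lookup m i))
     = eval_mpoly (homogeneous_part d p) x"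
    unfolding eval_mpoly_def
    by (rule sum.cong) (auto simp: in_keys_iff lookup_homogeneous_part split: if_splits)
  ultimately show ?thesis
    unfolding eval_mpoly_def[of p]
    by (metis (no_types, lifting) finite_keys finite_Un sum.union_disjoint)
qed

lemma eval_homogeneous_part_scale:
  fixes p :: "('a::comm_semiring_1, 'n::finite) mpoly"
  shows "eval_mpoly (homogeneous_part d p) (c *s x) = c ^ d * eval_mpoly (homogeneous_part d p) x"
proof -
  have "(\<Prod>i\<in>UNIV. (c *s x) $ i ^ Poly_Mapping.lookup m i)
      = c ^ d * (\<Prod>i\<in>UNIV. x $ i ^ Poly_Mapping.lookup m i)"
    if "m \<in> Poly_Mapping.keys (homogeneous_part d p)" for m
    using that
    by (auto simp: in_keys_iff lookup_homogeneous_part monomial_degree_def power_mult_distrib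
        prod.distrib power_sum split: if_splits)
  then show ?thesis
    unfolding eval_mpoly_def sum_distrib_left
    by (intro sum.cong) (auto simp: algebra_simps)
qed

lemma norm_monomial_le:
  fixes x :: "complex ^ 'n::finite"
  shows "norm (\<Prod>i\<in>UNIV. x $ i ^ Poly_Mapping.lookup m i) \<le> norm x ^ monomial_degree m"
proof -
  have "norm (\<Prod>i\<in>UNIV. x $ i ^ Poly_Mapping.lookup m i)
      = (\<Prod>i\<in>UNIV. norm (x $ i) ^ Poly_Mapping.lookup m i)"
    by (simp add: prod_norm[symmetric] norm_power)
  also have "\<dots> \<le> (\<Prod>i\<in>UNIV. norm x ^ Poly_Mapping.lookup m i)"
    by (intro prod_mono conjI power_mono Finite_Cartesian_Product.norm_nth_le) auto
  also have "\<dots> = norm x ^ monomial_degree m"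
    by (simp add: power_sum monomial_degree_def)
  finally show ?thesis .
qed

text \<open>The remaining monomials have degree at most \<open>k\<close>, and outside the unit ball
  powers of the norm grow with the exponent. The sum of the coefficient norms serves as
  \<open>K\<close>. Writing the degree as \<open>Suc k\<close> avoids subtraction on
  naturals.\<close>

lemma norm_lower_part_le:
  fixes p :: "(complex, 'n::finite) mpoly"
  assumes "total_degree p \<le> Suc k"
  obtains K where "\<And>x. 1 \<le> norm x \<Longrightarrow>
    norm (eval_mpoly p x - eval_mpoly (homogeneous_part (Suc k) p) x) \<le> K * norm x ^ k"
proof -
  let ?L = "{m\<in>Poly_Mapping.keys p. monomial_degree m < Suc k}"
  have "norm (eval_mpoly p x - eval_mpoly (homogeneous_part (Suc k) p) x)
      \<le> (\<Sum>m\<in>?L. norm (Poly_Mapping.lookup p m)) * norm x ^ k" if "1 \<le> norm x" for x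
    unfolding eval_mpoly_split[OF assms] add_diff_cancel_left' sum_distrib_right
  proof (rule sum_norm_le)
    fix m assume "m \<in> ?L"
    then have "norm x ^ monomial_degree m \<le> norm x ^ k"
      using that by (intro power_increasing) auto
    then show "norm (Poly_Mapping.lookup p m * (\<Prod>i\<in>UNIV. x $ i ^ Poly_Mapping.lookup m i))
        \<le> norm (Poly_Mapping.lookup p m) * norm x ^ k"
      unfolding norm_mult using norm_monomial_le[of x m]
      by (intro mult_left_mono) auto
  qed
  then show thesis using that by blast
qed

lemma continuous_on_eval_poly_map:
  fixes G :: "(complex, 'n::finite) poly_map"
  shows "continuous_on S (eval_poly_map G)"
  unfolding eval_poly_map_def eval_mpoly_def by (intro continuous_intros)

text \<open>At a zero of \<open>G\<close> the top part is the negative of the lower part, so growth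
  of order \<open>Suc k\<close> from below meets growth of order \<open>k\<close> from
  above.\<close>

lemma bounded_zeros_poly_map:
  fixes G :: "(complex, 'n::finite) poly_map"
  assumes deg: "poly_map_degree G = Suc k"
    and hom: "\<And>y. eval_poly_map (homogeneous_part_map (Suc k) G) y = 0 \<Longrightarrow> y = 0"
  shows "bounded {y. eval_poly_map G y = 0}"
proof -
  let ?H = "eval_poly_map (homogeneous_part_map (Suc k) G)"
  have "\<exists>K. \<forall>x. 1 \<le> norm x \<longrightarrow> norm (eval_poly_map G x $ i - ?H x $ i) \<le> K * norm x ^ k" for i
  proof -
    have "total_degree (G $ i) \<le> Suc k"
      using deg unfolding poly_map_degree_def by (metis Max_ge finite finite_imageI rangeI)
    then show ?thesis
      using norm_lower_part_le[of "G $ i" k]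
      by (metis (no_types, lifting) eval_poly_map_def homogeneous_part_map_def vec_lambda_beta)
  qed
  then obtain K where K: "\<And>i x. 1 \<le> norm x \<Longrightarrow>
      norm (eval_poly_map G x $ i - ?H x $ i) \<le> K i * norm x ^ k" by metis
  have "continuous_on (sphere 0 1) (\<lambda>x. norm (?H x))"
    by (intro continuous_on_norm continuous_on_eval_poly_map)
  moreover have "sphere (0 :: complex ^ 'n) 1 \<noteq> {}" by simp
  ultimately obtain z where z: "z \<in> sphere 0 1" and
    zmin: "\<And>x. x \<in> sphere 0 1 \<Longrightarrow> norm (?H z) \<le> norm (?H x)"
    using continuous_attains_inf[OF compact_sphere] by metis
  \<comment> \<open>The minimum of the top part on the unit sphere; it is positive because the
    minimiser \<open>z\<close> is nonzero.\<close>
  define \<mu> where "\<mu> = norm (?H z)"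
  have "z \<noteq> 0" using z by auto
  then have \<mu>: "\<mu> > 0" using hom[of z] unfolding \<mu>_def by auto
  have scale: "?H (b *s v) = b ^ Suc k *s ?H v" for b v
    by (simp add: vec_eq_iff eval_poly_map_def homogeneous_part_map_def
        eval_homogeneous_part_scale del: power_Suc)
  have low: "\<mu> * norm y ^ Suc k \<le> norm (?H y)" for y
  proof (cases "y = 0")
    case False
    \<comment> \<open>The norm is embedded into the complex numbers since homogeneity concerns
      complex scalars; dividing by it moves \<open>y\<close> to the unit sphere.\<close>
    define c where "c = complex_of_real (norm y)"
    define x where "x = inverse c *s y"
    have c: "c \<noteq> 0" "norm c = norm y" using False by (auto simp: c_def)
    have ns: "norm (b *s v) = norm b * norm v" for b and v :: "complex ^ 'n"
      by (simp add: norm_vec_def norm_mult L2_set_right_distrib)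
    have "norm x = 1" using False c by (simp add: x_def ns norm_inverse)
    then have "\<mu> \<le> norm (?H x)" using zmin unfolding \<mu>_def by simp
    moreover have "y = c *s x" using c by (simp add: x_def vec_eq_iff)
    then have "?H y = c ^ Suc k *s ?H x" using scale by metis
    then have "norm (?H y) = norm y ^ Suc k * norm (?H x)"
      using c by (simp only: ns norm_power)
    ultimately show ?thesis
      by (simp only:) (metis mult.commute mult_left_mono norm_ge_zero zero_le_power)
  qed simp
  have "norm y \<le> max 1 ((\<Sum>i\<in>UNIV. K i) / \<mu>)" if "eval_poly_map G y = 0" for y
  proof (cases "1 \<le> norm y")
    case True
    have "\<mu> * norm y ^ Suc k \<le> norm (?H y)" by (rule low)
    also have "\<dots> \<le> (\<Sum>i\<in>UNIV. norm (?H y $ i))"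
      unfolding norm_vec_def by (rule L2_set_le_sum) simp
    \<comment> \<open>Since \<open>G\<close> vanishes at \<open>y\<close>, the difference bounded by
      \<open>K\<close> is just the negative of the top part.\<close>
    also have "\<dots> \<le> (\<Sum>i\<in>UNIV. K i * norm y ^ k)"
      using K[OF True] that by (intro sum_mono) simp
    finally have "(\<mu> * norm y) * norm y ^ k \<le> (\<Sum>i\<in>UNIV. K i) * norm y ^ k"
      by (simp add: sum_distrib_right mult_ac)
    moreover have "0 < norm y ^ k" using True by (intro zero_less_power) linarith
    ultimately have "\<mu> * norm y \<le> (\<Sum>i\<in>UNIV. K i)" by (simp add: mult_le_cancel_right)
    then show ?thesis using \<mu> by (simp add: field_simps le_max_iff_disj)
  qed simp
  then show ?thesis unfolding bounded_iff by blast
qed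

theorem theorem4:
  fixes G :: "(complex, 'n::finite) poly_map" and d :: nat
  assumes "poly_map_degree G = d"
    and "\<forall>y. eval_poly_map (homogeneous_part_map d G) y = 0 \<longleftrightarrow> y = 0"
  shows "finite {y :: complex ^ 'n. eval_poly_map G y = 0}"
proof (cases d)
  case 0
  \<comment> \<open>Scaling by \<open>0\<close> with \<open>0 ^ 0 = 1\<close> shows that the part of
    degree zero is constant. It would then vanish at the all-ones vector as well as at
    \<open>0\<close>, so the uniqueness hypothesis excludes this case.\<close>
  have "eval_mpoly (homogeneous_part 0 p) y = eval_mpoly (homogeneous_part 0 p) 0"
    for p :: "(complex, 'n) mpoly" and y
    using eval_homogeneous_part_scale[of 0 p 0 y] by simp
  then have "eval_poly_map (homogeneous_part_map 0 G) 1 = eval_poly_map (homogeneous_part_map 0 G) 0"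
    by (simp add: eval_poly_map_def homogeneous_part_map_def vec_eq_iff)
  then have "(1 :: complex ^ 'n) = 0" using assms(2) 0 by metis
  then show ?thesis by simp
next
  case (Suc k)
  let ?E = "range (\<lambda>i. eval_mpoly (G $ i))"
  have zeros: "{y. eval_poly_map G y = 0} = {y. \<forall>g\<in>?E. g y = 0}"
    by (auto simp: eval_poly_map_def vec_eq_iff)
  have "bounded {y. eval_poly_map G y = 0}"
  proof (rule bounded_zeros_poly_map)
    show "poly_map_degree G = Suc k" using assms(1) Suc by simp
    show "y = 0" if "eval_poly_map (homogeneous_part_map (Suc k) G) y = 0" for y
      using assms(2)[rule_format, of y] that unfolding Suc by (rule iffD1)
  qed
  then show ?thesis
    unfolding zeros by (intro finite_bounded_algebraic_set image_subsetI eval_mpoly_poly_funs)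
qed

end
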